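(* Let $\mathcal M$ be a multiset with $b_i\ge 1$ copies of $i$ for $1\le i\le T$, and let $b=b_1+\dots+b_T$. Let $s_1,\dots,s_b\ge 0$ with $\sum_i s_i=1$ and $s_b>0$, and let $0<\alpha_i<1$ for $1\le i\le b-b_T$. Then the (unique) stationary distribution $\pi$ of the Multispecies Reverse Juggling Markov Chain (MRJMC) on $S(\mathcal M)$ with jump probabilities $s_1,\dots,s_b$ and non-bump probabilities $\alpha_1,\dots,\alpha_{b-b_T}$ is given by $$\pi(\tau)=\frac{1}{Z_{\mathbf b}(\alpha_1,\dots,\alpha_{b-b_T})}\,\alpha^{\mathbf c}(\tau),\qquad \tau\in S(\mathcal M),$$ where $Z_{\mathbf b}(\alpha_1,\dots,\alpha_{b-b_T})=\sum_{\sigma\in S(\mathcal M)}\alpha^{\mathbf c}(\sigma)$ is the partition function (normalizing constant).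
   Context: $S(\mathcal M)$ is the set of multipermutations $\tau=(\tau_1,\dots,\tau_b)$ of $\mathcal M$ (arrangements of all its elements); $\tau_j$ is thought of as the label of a ball at position $j$. Code and weight: for $\tau\in S(\mathcal M)$ let $c_i=c_i(\tau)=\#\{k: i<k,\ \tau_i>\tau_k\}$ and $\alpha^{\mathbf c}(\tau)=\prod_{i=1}^b \alpha_1\alpha_2\cdots\alpha_{c_i}$ (an empty product is $1$). MRJMC: the states are $\tau\in S(\mathcal M)$. From $\tau$, with probability $s_j$ ($1\le j\le b$) the ball in position $j$ starts a bumping path to the left, as follows. Suppose there are $\ell$ balls with labels smaller than $\tau_j$ to the left of position $j$ in $\tau$, at positions $i_1<\dots<i_\ell<j$, and $r$ balls with labels smaller than $\tau_j$ to the right of position $j$ in $\tau$. Then the ball $\tau_j$ bumps the ball at position $i_k$ ($1\le k\le \ell$), i.e. takes its place, with probability $(1-\alpha_{r+\ell-k+1})\prod_{s=1}^{\ell-k}\alpha_{r+s}$, or moves to the front ("position zero") without bumping any ball, with probability $\prod_{s=1}^{\ell}\alpha_{r+s}$. (That is, moving left, at the first, second, ... smaller ball encountered it fails to bump with probability $\alpha_{r+1},\alpha_{r+2},\dots$ respectively, until it bumps.) If the ball at position $i_k$ is bumped, the same step is repeated with $j$ replaced by $i_k$, i.e. for the ball labelled $\tau_{i_k}$ starting from position $i_k$ (with the corresponding new values of $\ell$, $r$ for that ball), and so on, until some ball is placed at position zero. Finally, if the path started at position $j$, all balls in positions $0,\dots,j-1$ are moved one step to the right, giving a new element of $S(\mathcal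 M)$. *)

theory Defs
  imports Complex_Main "HOL-Combinatorics.Multiset_Permutations"
begin

text \<open>
  Multipermutations are lists, with positions numbered from 1 as usual in the literature;
  position 0 is reserved for the place in front of the leftmost ball.
  The set of multipermutations of a multiset \<open>M\<close> is \<^const>\<open>permutations_of_multiset\<close>\<open> M\<close>.
\<close>

definition ball_at :: "nat list \<Rightarrow> nat \<Rightarrow> nat" where
  "ball_at \<tau> i = \<tau> ! (i - 1)"

definition code :: "nat list \<Rightarrow> nat \<Rightarrow> nat" where
  "code \<tau> i = card {k. i < k \<and> k \<le> length \<tau> \<and> ball_at \<tau> i > ball_at \<tau> k}"

definition code_weight :: "(nat \<Rightarrow> real) \<Rightarrow> nat list \<Rightarrow> real" where
  "code_weight \<alpha> \<tau> = (\<Prod>i=1..length \<tau>. \<Prod>u=1..code \<tau> i. \<alpha> u)"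

definition partition_fun :: "nat multiset \<Rightarrow> (nat \<Rightarrow> real) \<Rightarrow> real" where
  "partition_fun M \<alpha> = (\<Sum>\<sigma>\<in>permutations_of_multiset M. code_weight \<alpha> \<sigma>)"

definition smaller_left :: "nat list \<Rightarrow> nat \<Rightarrow> nat set" where
  "smaller_left \<tau> j = {i. 1 \<le> i \<and> i < j \<and> ball_at \<tau> i < ball_at \<tau> j}"

definition smaller_right :: "nat list \<Rightarrow> nat \<Rightarrow> nat set" where
  "smaller_right \<tau> j = {i. j < i \<and> i \<le> length \<tau> \<and> ball_at \<tau> i < ball_at \<tau> j}"

text \<open>
  \<open>bump_prob \<alpha> \<tau> j i\<close> is the probability that the ball at position \<open>j\<close> takes position \<open>i\<close>.
  If \<open>i\<^sub>1 < \<dots> < i\<^sub>l\<close> are the elements of \<open>smaller_left \<tau> j\<close>, then the number \<open>k\<close> below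
  is the index with \<open>i = i\<^sub>k\<close>.
  The balls displaced earlier on a bumping path all have labels larger than that of the ball now
  moving, so its smaller balls to the left and right can be counted in the original \<open>\<tau>\<close>.
\<close>

definition bump_prob :: "(nat \<Rightarrow> real) \<Rightarrow> nat list \<Rightarrow> nat \<Rightarrow> nat \<Rightarrow> real" where
  "bump_prob \<alpha> \<tau> j i =
     (let l = card (smaller_left \<tau> j); r = card (smaller_right \<tau> j)
      in if i = 0 then (\<Prod>u=1..l. \<alpha> (r + u))
         else if i \<in> smaller_left \<tau> j then
           (let k = card {h \<in> smaller_left \<tau> j. h \<le> i}
            in (1 - \<alpha> (r + l - k + 1)) * (\<Prod>u=1..l - k. \<alpha> (r + u)))
         else 0)"

text \<open>
  A bumping path started at \<open>j\<close> is given by the list \<open>[j, p\<^sub>1, \<dots>, p\<^sub>m, 0]\<close> of the positions visited: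
  the ball at \<open>j\<close> bumps the one at \<open>p\<^sub>1\<close>, which bumps the one at \<open>p\<^sub>2\<close>, and so on, and the ball
  at \<open>p\<^sub>m\<close> goes to position 0. Lists in which some ball would bump a ball that is not smaller
  have probability 0.
\<close>

definition bump_paths :: "nat \<Rightarrow> nat list set" where
  "bump_paths j = {p. p \<noteq> [] \<and> sorted_wrt (>) p \<and> hd p = j \<and> last p = 0}"

fun path_prob :: "(nat \<Rightarrow> real) \<Rightarrow> nat list \<Rightarrow> nat list \<Rightarrow> real" where
  "path_prob \<alpha> \<tau> (i # i' # p) = bump_prob \<alpha> \<tau> i i' * path_prob \<alpha> \<tau> (i' # p)"
| "path_prob \<alpha> \<tau> _ = 1"

text \<open>
  \<open>bump f p\<close> is the arrangement (of labels on positions) obtained from \<open>f\<close> by moving, for each two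
  consecutive entries \<open>i, i'\<close> of the path \<open>p\<close>, the ball \<open>f i\<close> to position \<open>i'\<close>.
\<close>

fun bump :: "(nat \<Rightarrow> nat) \<Rightarrow> nat list \<Rightarrow> nat \<Rightarrow> nat" where
  "bump f (i # i' # p) = (bump f (i' # p))(i' := f i)"
| "bump f _ = f"

definition path_result :: "nat list \<Rightarrow> nat list \<Rightarrow> nat list" where
  "path_result \<tau> p =
     map (\<lambda>i. if i \<le> hd p then bump (ball_at \<tau>) p (i - 1) else ball_at \<tau> i) [1..<Suc (length \<tau>)]"

definition mrjmc :: "(nat \<Rightarrow> real) \<Rightarrow> (nat \<Rightarrow> real) \<Rightarrow> nat list \<Rightarrow> nat list \<Rightarrow> real" where
  "mrjmc s \<alpha> \<tau> \<tau>' =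
     (\<Sum>j=1..length \<tau>. s j * (\<Sum>p\<in>{p \<in> bump_paths j. path_result \<tau> p = \<tau>'}. path_prob \<alpha> \<tau> p))"

definition stationary_distribution :: "'a set \<Rightarrow> ('a \<Rightarrow> 'a \<Rightarrow> real) \<Rightarrow> ('a \<Rightarrow> real) \<Rightarrow> bool" where
  "stationary_distribution S P \<pi> \<longleftrightarrow>
     (\<forall>x\<in>S. 0 \<le> \<pi> x) \<and> (\<Sum>x\<in>S. \<pi> x) = 1 \<and> (\<forall>y\<in>S. (\<Sum>x\<in>S. \<pi> x * P x y) = \<pi> y)"

end

theory Submission
  imports Defs
begin

text \<open>
  A jump from position \<open>j\<close> factors into local steps: carry a ball leftwards and, at positions
  \<open>i, i + 1\<close> with the carried ball at \<open>i + 1\<close>, either exchange the two balls and keep carrying the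
  same one, or leave them in place and carry the ball at \<open>i\<close> from then on. The second alternative
  is possible only at an ascent, where it has probability \<open>1 - \<alpha>\<^bsub>c+1\<^esub>\<close>, with \<open>c\<close> the current code entry
  of the carried ball. As exchanging an ascent multiplies the code weight by \<open>\<alpha>\<^bsub>c+1\<^esub>\<close>, every local
  step is reversible with respect to the code weight, so every jump preserves it.

  For uniqueness, consider the density \<open>h\<close> of a stationary distribution relative to the code weight.
  A local step decreases the weighted sum of \<open>h\<^sup>2\<close> strictly unless \<open>h\<close> is invariant under the
  exchange. Since \<open>s\<^sub>b > 0\<close>, stationarity leaves no room for a decrease in a jump from the
  last position, which uses all the exchanges; hence \<open>h\<close> is constant.
\<close>

section \<open>Adjacent exchanges\<close>

text \<open>Positions are counted from 1, so positions \<open>i\<close> and \<open>i + 1\<close> are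
  the list indices \<open>i - 1\<close> and \<open>i\<close>; a proper exchange means
  \<open>1 \<le> i\<close> and \<open>i < length u\<close>.\<close>

definition swap_adj :: "nat \<Rightarrow> 'a list \<Rightarrow> 'a list" where
  "swap_adj i u = u[i - 1 := u ! i, i := u ! (i - 1)]"

lemma length_swap_adj [simp]: "length (swap_adj i u) = length u"
  by (simp add: swap_adj_def)

lemma mset_swap_adj: "i < length u \<Longrightarrow> mset (swap_adj i u) = mset u"
  unfolding swap_adj_def by (rule mset_swap) auto

lemma swap_adj_in_permutations:
  "i < size M \<Longrightarrow> u \<in> permutations_of_multiset M \<Longrightarrow> swap_adj i u \<in> permutations_of_multiset M"
  by (metis mset_swap_adj permutations_of_multisetD permutations_of_multisetI size_mset)

lemma swap_adj_swap_adj: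
  assumes "1 \<le> i" "i < length u"
  shows "swap_adj i (swap_adj i u) = u"
  using assms by (intro nth_equalityI) (auto simp: swap_adj_def nth_list_update)

lemma swap_adj_eq: "ball_at u i = ball_at u (Suc i) \<Longrightarrow> swap_adj i u = u"
  by (simp add: swap_adj_def ball_at_def) (metis list_update_id)

lemma ball_at_swap_adj:
  assumes "1 \<le> i" "i < length u" "1 \<le> t"
  shows "ball_at (swap_adj i u) t = ball_at u (transpose i (Suc i) t)"
  using assms by (auto simp: swap_adj_def ball_at_def nth_list_update transpose_def)

section \<open>Code entries and code weight under an exchange\<close>

lemma code_eq_card_smaller_right: "code u i = card (smaller_right u i)"
  by (simp add: code_def smaller_right_def)

text \<open>The exchange renames positions by a transposition, so both sides count the same balls,
  once by new and once by old position. The code lemmas below are its instances.\<close>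

lemma card_smaller_right_swap_adj:
  assumes "1 \<le> i" "i < length u" "1 \<le> t"
  shows "card (smaller_right (swap_adj i u) (transpose i (Suc i) t)) =
    card {k. transpose i (Suc i) t < transpose i (Suc i) k \<and> 1 \<le> k \<and> k \<le> length u
             \<and> ball_at u k < ball_at u t}" (is "card ?A = card ?B")
proof -
  let ?\<sigma> = "transpose i (Suc i)" and ?n = "length u"
  have range: "1 \<le> ?\<sigma> k \<and> (?\<sigma> k \<le> ?n \<longleftrightarrow> k \<le> ?n)" if "1 \<le> k" for k
    using that assms by (auto simp: transpose_def)
  have ball: "ball_at (swap_adj i u) k = ball_at u (?\<sigma> k)" if "1 \<le> k" for k
    using that assms by (simp add: ball_at_swap_adj)
  have memA: "k \<in> ?A \<longleftrightarrow> ?\<sigma> t < k \<and> k \<le> ?n \<and> ball_at u (?\<sigma> k) < ball_at u t" if "1 \<le> k" for k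
    using that ball[OF that] ball[of "?\<sigma> t"] range[OF assms(3)] by (simp add: smaller_right_def)
  have posA: "1 \<le> k" if "k \<in> ?A" for k
    using that by (simp add: smaller_right_def)
  have "?A = ?\<sigma> ` ?B"
  proof (intro set_eqI iffI)
    fix k assume k: "k \<in> ?A"
    have "?\<sigma> k \<in> ?B" using k posA[OF k] memA[OF posA[OF k]] range[OF posA[OF k]] by simp
    then have "?\<sigma> (?\<sigma> k) \<in> ?\<sigma> ` ?B" by (rule imageI)
    then show "k \<in> ?\<sigma> ` ?B" by (simp only: transpose_involutory)
  next
    fix k assume "k \<in> ?\<sigma> ` ?B"
    then obtain k' where k': "k = ?\<sigma> k'" "k' \<in> ?B" by blast
    then have k'1: "1 \<le> k'" by simp
    have "1 \<le> k" using range[OF k'1] k'(1) by simp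
    then show "k \<in> ?A" using memA[of k] k' range[OF k'1] by simp
  qed
  then show ?thesis by (simp add: card_image)
qed

text \<open>The ball that moves left gains the ball it passes on its right, which counts exactly
  when it is smaller.\<close>

lemma code_swap_adj_left:
  assumes "1 \<le> i" "i < length u"
  shows "code (swap_adj i u) i =
    code u (Suc i) + (if ball_at u i < ball_at u (Suc i) then 1 else 0)"
proof -
  have fin: "finite (smaller_right u (Suc i))" by (simp add: smaller_right_def)
  have "code (swap_adj i u) i = card {k. i < transpose i (Suc i) k \<and> 1 \<le> k \<and> k \<le> length u
             \<and> ball_at u k < ball_at u (Suc i)}" (is "_ = card ?B")
    using card_smaller_right_swap_adj[OF assms, of "Suc i"]
    by (simp add: code_eq_card_smaller_right)
  also have "?B = (if ball_at u i < ball_at u (Suc i) then insert i (smaller_right u (Suc i))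
      else smaller_right u (Suc i))"
    using assms by (auto simp: smaller_right_def transpose_def split: if_splits)
  finally show ?thesis using fin
    by (auto simp: code_eq_card_smaller_right) (auto simp: smaller_right_def)
qed

text \<open>The ball that moves right passes only a larger ball, which its code entry never
  counts.\<close>

lemma code_swap_adj_right:
  assumes "1 \<le> i" "i < length u" "ball_at u i < ball_at u (Suc i)"
  shows "code (swap_adj i u) (Suc i) = code u i"
proof -
  have "code (swap_adj i u) (Suc i) = card {k. Suc i < transpose i (Suc i) k \<and> 1 \<le> k \<and> k \<le> length u
             \<and> ball_at u k < ball_at u i}" (is "_ = card ?B")
    using card_smaller_right_swap_adj[OF assms(1,2), of i] assms
    by (simp add: code_eq_card_smaller_right)
  also have "?B = smaller_right u i"
    using assms by (auto simp: smaller_right_def transpose_def split: if_splits)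
  finally show ?thesis by (simp add: code_eq_card_smaller_right)
qed

text \<open>The two exchanged positions lie on the same side of \<open>t\<close>.\<close>

lemma code_swap_adj_other:
  assumes "1 \<le> i" "i < length u" "1 \<le> t" "t \<noteq> i" "t \<noteq> Suc i"
  shows "code (swap_adj i u) t = code u t"
proof -
  have "code (swap_adj i u) t = card {k. t < transpose i (Suc i) k \<and> 1 \<le> k \<and> k \<le> length u
             \<and> ball_at u k < ball_at u t}" (is "_ = card ?B")
    using card_smaller_right_swap_adj[OF assms(1,2), of t] assms
    by (simp add: code_eq_card_smaller_right)
  also have "?B = smaller_right u t"
    using assms by (auto simp: smaller_right_def transpose_def split: if_splits)
  finally show ?thesis by (simp add: code_eq_card_smaller_right)
qed

text \<open>One code entry grows by 1 and contributes one new factor; the others are at most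
  permuted.\<close>

lemma code_weight_swap_adj:
  assumes "1 \<le> i" "i < length u" "ball_at u i < ball_at u (Suc i)"
  shows "code_weight \<alpha> (swap_adj i u) = \<alpha> (Suc (code u (Suc i))) * code_weight \<alpha> u"
proof -
  let ?R = "{1..length u} - {i, Suc i}"
  have split: "(\<Prod>t=1..length u. f t) = f i * f (Suc i) * (\<Prod>t\<in>?R. f t)" for f :: "nat \<Rightarrow> real"
  proof -
    have "{1..length u} = insert i (insert (Suc i) ?R)" using assms by auto
    then have "(\<Prod>t=1..length u. f t) = prod f (insert i (insert (Suc i) ?R))" by simp
    also have "\<dots> = f i * f (Suc i) * (\<Prod>t\<in>?R. f t)" by (simp add: mult.assoc)
    finally show ?thesis .
  qed
  have "(\<Prod>t\<in>?R. \<Prod>v=1..code (swap_adj i u) t. \<alpha> v) = (\<Prod>t\<in>?R. \<Prod>v=1..code u t. \<alpha> v)"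
    using assms by (intro prod.cong) (auto simp: code_swap_adj_other)
  then show ?thesis
    unfolding code_weight_def length_swap_adj split
    using assms by (simp add: code_swap_adj_left code_swap_adj_right)
qed

section \<open>Local steps\<close>

text \<open>This is the probability of a bump: the carried ball takes place \<open>i\<close>, and
  the concluding shift to the right returns it to \<open>i + 1\<close>, so both balls stay. Its code
  entry is its original number of smaller balls to the right plus the number of smaller balls
  already passed.\<close>

definition stay_prob :: "(nat \<Rightarrow> real) \<Rightarrow> nat \<Rightarrow> nat list \<Rightarrow> real" where
  "stay_prob \<alpha> i u =
     (if ball_at u i < ball_at u (Suc i) then 1 - \<alpha> (Suc (code u (Suc i))) else 0)"

definition lazy_swap :: "(nat \<Rightarrow> real) \<Rightarrow> nat \<Rightarrow> (nat list \<Rightarrow> real) \<Rightarrow> nat list \<Rightarrow> real" where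
  "lazy_swap \<alpha> i g u = stay_prob \<alpha> i u * g u + (1 - stay_prob \<alpha> i u) * g (swap_adj i u)"

text \<open>
  These operators act on functions of the state, so in \<open>bump_op\<close> the outermost local step, the one
  with the largest index, is the first that the chain performs.
  \<open>bump_op \<alpha> (j - 1)\<close> belongs to the jumps from position \<open>j\<close>.
\<close>

primrec bump_op :: "(nat \<Rightarrow> real) \<Rightarrow> nat \<Rightarrow> (nat list \<Rightarrow> real) \<Rightarrow> nat list \<Rightarrow> real" where
  "bump_op \<alpha> 0 g = g"
| "bump_op \<alpha> (Suc i) g = lazy_swap \<alpha> (Suc i) (bump_op \<alpha> i g)"

primrec bump_adj :: "(nat \<Rightarrow> real) \<Rightarrow> nat \<Rightarrow> (nat list \<Rightarrow> real) \<Rightarrow> nat list \<Rightarrow> real" where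
  "bump_adj \<alpha> 0 h = h"
| "bump_adj \<alpha> (Suc i) h = bump_adj \<alpha> i (lazy_swap \<alpha> (Suc i) h)"

text \<open>At an ascent the exchange has probability \<alpha> with index one above the code entry
  of the carried ball, which is also the ratio of the weights; the way back is certain. Descents
  follow by exchanging again, and for equal labels the exchange is the identity.\<close>

lemma detailed_balance:
  assumes "1 \<le> i" "i < length u"
  shows "code_weight \<alpha> (swap_adj i u) * (1 - stay_prob \<alpha> i (swap_adj i u)) =
    code_weight \<alpha> u * (1 - stay_prob \<alpha> i u)"
proof -
  have ball: "ball_at (swap_adj i u) i = ball_at u (Suc i)" "ball_at (swap_adj i u) (Suc i) = ball_at u i"
    using assms by (auto simp: ball_at_swap_adj)
  consider "ball_at u i < ball_at u (Suc i)" | "ball_at u i > ball_at u (Suc i)"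
    | "ball_at u i = ball_at u (Suc i)" by linarith
  then show ?thesis
  proof cases
    case 1
    then show ?thesis using assms ball by (simp add: stay_prob_def code_weight_swap_adj)
  next
    case 2
    then show ?thesis
      using code_weight_swap_adj[of i "swap_adj i u" \<alpha>] assms ball
      by (simp add: stay_prob_def swap_adj_swap_adj)
  next
    case 3
    then show ?thesis by (simp add: swap_adj_eq)
  qed
qed

lemma bij_betw_swap_adj:
  assumes "1 \<le> i" "i < size M"
  shows "bij_betw (swap_adj i) (permutations_of_multiset M) (permutations_of_multiset M)"
  using assms by (intro bij_betw_byWitness[where f' = "swap_adj i"])
    (auto simp: swap_adj_in_permutations length_finite_permutations_of_multiset swap_adj_swap_adj)

text \<open>The staying part is diagonal. In the other part, substituting
  \<open>swap_adj i u\<close> for \<open>u\<close> and detailed balance move the exchange from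
  \<open>g\<close> to \<open>h\<close>.\<close>

lemma lazy_swap_self_adjoint:
  assumes "1 \<le> i" "i < size M"
  shows "(\<Sum>u\<in>permutations_of_multiset M. code_weight \<alpha> u * h u * lazy_swap \<alpha> i g u) =
    (\<Sum>u\<in>permutations_of_multiset M. code_weight \<alpha> u * lazy_swap \<alpha> i h u * g u)"
proof -
  let ?S = "permutations_of_multiset M" and ?w = "code_weight \<alpha>"
    and ?q = "\<lambda>u. 1 - stay_prob \<alpha> i u"
  have len: "length u = size M" if "u \<in> ?S" for u
    using that by (simp add: length_finite_permutations_of_multiset)
  have "(\<Sum>u\<in>?S. ?w u * ?q u * h u * g (swap_adj i u)) =
    (\<Sum>u\<in>?S. ?w (swap_adj i u) * ?q (swap_adj i u) * h (swap_adj i u) * g (swap_adj i (swap_adj i u)))"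
    using sum.reindex_bij_betw[OF bij_betw_swap_adj[OF assms],
        of "\<lambda>u. ?w u * ?q u * h u * g (swap_adj i u)"] by simp
  also have "\<dots> = (\<Sum>u\<in>?S. ?w u * ?q u * h (swap_adj i u) * g u)"
    using assms len by (intro sum.cong) (auto simp: detailed_balance swap_adj_swap_adj)
  finally have "(\<Sum>u\<in>?S. ?w u * ?q u * h u * g (swap_adj i u)) =
    (\<Sum>u\<in>?S. ?w u * ?q u * h (swap_adj i u) * g u)" .
  then show ?thesis
    unfolding lazy_swap_def
    by (simp add: algebra_simps sum.distrib sum_subtractf)
qed

text \<open>\<open>bump_adj\<close> composes the same self-adjoint steps in the opposite order; they
  cross the weighted inner product one at a time, and \<open>h\<close> varies to absorb
  them.\<close>

lemma bump_op_adjoint: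
  assumes "i < size M"
  shows "(\<Sum>u\<in>permutations_of_multiset M. code_weight \<alpha> u * h u * bump_op \<alpha> i g u) =
    (\<Sum>u\<in>permutations_of_multiset M. code_weight \<alpha> u * bump_adj \<alpha> i h u * g u)"
  using assms
proof (induction i arbitrary: h)
  case (Suc i)
  then show ?case using lazy_swap_self_adjoint[of "Suc i" M \<alpha> h "bump_op \<alpha> i g"] by simp
qed simp

lemma lazy_swap_const: "lazy_swap \<alpha> i (\<lambda>_. c) = (\<lambda>_. c)"
  by (intro ext) (simp add: lazy_swap_def algebra_simps)

text \<open>In terms of densities relative to the code weight, this is the invariance of the code
  weight under a jump.\<close>

lemma bump_adj_const: "bump_adj \<alpha> i (\<lambda>_. c) = (\<lambda>_. c)"
  by (induction i) (simp_all add: lazy_swap_const)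


section \<open>Bumping paths as sequences of local steps\<close>

lemma bump_paths_0: "bump_paths 0 = {[0]}"
proof -
  have "p = [0]" if "p \<in> bump_paths 0" for p
    using that by (cases p) (auto simp: bump_paths_def split: if_splits)
  then show ?thesis by (auto simp: bump_paths_def)
qed

lemma bump_paths_pos:
  assumes "0 < j"
  shows "bump_paths j = (\<Union>i<j. (#) j ` bump_paths i)"
proof (intro set_eqI iffI)
  fix p assume p: "p \<in> bump_paths j"
  then obtain q where q: "p = j # q" by (cases p) (auto simp: bump_paths_def)
  with p assms have "q \<noteq> []" by (auto simp: bump_paths_def)
  then have "q \<in> bump_paths (hd q)" "hd q < j" using p q by (auto simp: bump_paths_def)
  then show "p \<in> (\<Union>i<j. (#) j ` bump_paths i)" using q by blast
next
  fix p assume "p \<in> (\<Union>i<j. (#) j ` bump_paths i)"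
  then obtain i q where q: "p = j # q" "i < j" "q \<in> bump_paths i" by blast
  from q(3) have "\<forall>x\<in>set q. x \<le> i"
    by (cases q) (auto simp: bump_paths_def)
  with q show "p \<in> bump_paths j" by (auto simp: bump_paths_def)
qed

lemma finite_bump_paths [simp]: "finite (bump_paths j)"
proof (induction j rule: less_induct)
  case (less j)
  show ?case
  proof (cases "j = 0")
    case False
    then have "bump_paths j = (\<Union>i<j. (#) j ` bump_paths i)" by (simp add: bump_paths_pos)
    also have "finite \<dots>" by (intro finite_UN_I finite_imageI less) auto
    finally show ?thesis .
  qed (simp add: bump_paths_0)
qed

lemma sum_bump_paths:
  assumes "0 < j"
  shows "(\<Sum>p\<in>bump_paths j. F p) = (\<Sum>i<j. \<Sum>q\<in>bump_paths i. F (j # q))"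
proof -
  have "(\<Sum>p\<in>bump_paths j. F p) = (\<Sum>i<j. \<Sum>p\<in>(#) j ` bump_paths i. F p)"
    unfolding bump_paths_pos[OF assms]
  proof (rule sum.UNION_disjoint)
    show "\<forall>i\<in>{..<j}. \<forall>i'\<in>{..<j}. i \<noteq> i' \<longrightarrow> (#) j ` bump_paths i \<inter> (#) j ` bump_paths i' = {}"
      by (auto simp: bump_paths_def)
  qed simp_all
  also have "\<dots> = (\<Sum>i<j. \<Sum>q\<in>bump_paths i. F (j # q))"
    by (simp add: sum.reindex)
  finally show ?thesis .
qed

lemma bump_pathsE:
  assumes "q \<in> bump_paths i"
  obtains q' where "q = i # q'" "sorted_wrt (>) q"
  using assms by (cases q) (auto simp: bump_paths_def)

section \<open>Bump probabilities and local steps\<close>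

lemma bump_prob_adjacent:
  assumes "1 \<le> i"
  shows "bump_prob \<alpha> u (Suc i) i = stay_prob \<alpha> i u"
proof (cases "ball_at u i < ball_at u (Suc i)")
  case True
  \<comment> \<open>Position \<open>i\<close> is the first one met, so \<open>k = l\<close>: the
    product is empty and the index of \<alpha> is \<open>r + 1\<close>.\<close>
  have "{h \<in> smaller_left u (Suc i). h \<le> i} = smaller_left u (Suc i)"
    by (auto simp: smaller_left_def)
  moreover have "i \<in> smaller_left u (Suc i)" using True assms by (simp add: smaller_left_def)
  ultimately show ?thesis
    using True assms by (simp add: bump_prob_def stay_prob_def code_eq_card_smaller_right)
next
  case False
  then show ?thesis using assms by (simp add: bump_prob_def stay_prob_def smaller_left_def)
qed

lemma finite_smaller_left [simp]: "finite (smaller_left u j)"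
  by (rule finite_subset[of _ "{..j}"]) (auto simp: smaller_left_def)

text \<open>At an ascent the failure to bump at \<open>i\<close> costs the first factor, with index
  \<open>r + 1\<close>. After the exchange \<open>r\<close> is one larger and \<open>l\<close> one
  smaller, so the remaining factors keep their indices. Otherwise the ball at \<open>i\<close> is
  not smaller, and passing it changes neither count.\<close>

lemma bump_prob_skip:
  assumes "1 \<le> i" "i < length u" "i' < i"
  shows "bump_prob \<alpha> u (Suc i) i' = (1 - stay_prob \<alpha> i u) * bump_prob \<alpha> (swap_adj i u) i i'"
proof -
  let ?v = "swap_adj i u"
  have ballv: "ball_at ?v h = ball_at u h" if "1 \<le> h" "h < i" for h
    using that assms by (simp add: ball_at_swap_adj)
  have ballvi: "ball_at ?v i = ball_at u (Suc i)" using assms by (simp add: ball_at_swap_adj)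
  have slv: "smaller_left ?v i = {h. 1 \<le> h \<and> h < i \<and> ball_at u h < ball_at u (Suc i)}"
    by (auto simp: smaller_left_def ballv ballvi)
  show ?thesis
  proof (cases "ball_at u i < ball_at u (Suc i)")
    case True
    have r: "card (smaller_right ?v i) = Suc (card (smaller_right u (Suc i)))"
      using code_swap_adj_left[OF assms(1,2)] True by (simp add: code_eq_card_smaller_right)
    have sl: "smaller_left u (Suc i) = insert i (smaller_left ?v i)"
      unfolding slv using True assms by (auto simp: smaller_left_def less_Suc_eq)
    have l: "card (smaller_left u (Suc i)) = Suc (card (smaller_left ?v i))"
      unfolding sl by (subst card_insert_disjoint) (auto, auto simp: smaller_left_def)
    have k: "{h \<in> smaller_left u (Suc i). h \<le> i'} = {h \<in> smaller_left ?v i. h \<le> i'}"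
      unfolding sl using assms by auto
    \<comment> \<open>Ensures that the truncated difference \<open>l - k\<close> grows by one
      together with \<open>l\<close>.\<close>
    have kl: "card {h \<in> smaller_left ?v i. h \<le> i'} \<le> card (smaller_left ?v i)"
      by (rule card_mono) auto
    have mem: "i' \<in> smaller_left u (Suc i) \<longleftrightarrow> i' \<in> smaller_left ?v i"
      unfolding sl using assms by auto
    have shift: "(\<Prod>w=Suc 0..Suc n. \<alpha> (r + w)) = \<alpha> (Suc r) * (\<Prod>w=Suc 0..n. \<alpha> (Suc (r + w)))" for n r :: nat
      by (simp add: prod.atLeast_Suc_atMost prod.shift_bounds_cl_Suc_ivl del: prod.cl_ivl_Suc)
    have "1 - stay_prob \<alpha> i u = \<alpha> (Suc (card (smaller_right u (Suc i))))"
      using True by (simp add: stay_prob_def code_eq_card_smaller_right)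
    then show ?thesis
      unfolding bump_prob_def Let_def mem k l r
      using kl by (auto simp: Suc_diff_le shift simp del: prod.cl_ivl_Suc)
  next
    case False
    have r: "card (smaller_right ?v i) = card (smaller_right u (Suc i))"
      using code_swap_adj_left[OF assms(1,2)] False by (simp add: code_eq_card_smaller_right)
    have sl: "smaller_left u (Suc i) = smaller_left ?v i"
      unfolding slv using False assms by (auto simp: smaller_left_def less_Suc_eq)
    show ?thesis
      unfolding bump_prob_def Let_def sl r using False by (simp add: stay_prob_def)
  qed
qed

text \<open>Both exchanged balls lie to the right of \<open>j\<close>, where only their number
  matters.\<close>

lemma bump_prob_swap_adj:
  assumes "1 \<le> i" "i < length u" "1 \<le> j" "j < i"
  shows "bump_prob \<alpha> (swap_adj i u) j k = bump_prob \<alpha> u j k"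
proof -
  have left: "smaller_left (swap_adj i u) j = smaller_left u j"
    using assms by (auto simp: smaller_left_def ball_at_swap_adj)
  have right: "card (smaller_right (swap_adj i u) j) = card (smaller_right u j)"
    using code_swap_adj_other[OF assms(1,2), of j] assms
    by (simp add: code_eq_card_smaller_right)
  show ?thesis unfolding bump_prob_def left right by (rule refl)
qed

lemma path_prob_swap_adj:
  assumes "1 \<le> i" "i < length u" "sorted_wrt (>) p" "\<forall>x\<in>set p. x < i"
  shows "path_prob \<alpha> (swap_adj i u) p = path_prob \<alpha> u p"
  using assms(3,4)
proof (induction p rule: induct_list012)
  case (3 x y p)
  then show ?case using assms(1,2) by (auto simp: bump_prob_swap_adj)
qed simp_all


section \<open>Arrangements produced by bumping paths\<close>

lemma bump_untouched: "k \<notin> set (tl p) \<Longrightarrow> bump f p k = f k"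
  by (induction f p rule: bump.induct) auto

text \<open>
  Nothing is assumed about \<open>f 0\<close> and \<open>g 0\<close>, which are junk values of \<^const>\<open>ball_at\<close>: a path that starts
  at a positive position overwrites the entry at 0.
\<close>

lemma bump_cong:
  assumes "\<And>k. 1 \<le> k \<Longrightarrow> k < n \<Longrightarrow> f k = g k" "p \<in> bump_paths j" "j < n" "k < n"
    and "1 \<le> k \<or> 1 \<le> j"
  shows "bump f p k = bump g p k"
  using assms(2-)
proof (induction j arbitrary: p rule: less_induct)
  case (less j)
  show ?case
  proof (cases "j = 0")
    case True
    then show ?thesis using less.prems assms(1) by (simp add: bump_paths_0)
  next
    case False
    then obtain i q where q: "p = j # q" "i < j" "q \<in> bump_paths i"
      using less.prems(1) by (auto simp: bump_paths_pos)
    then obtain q' where q': "q = i # q'" by (auto elim: bump_pathsE)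
    show ?thesis
    proof (cases "k = i")
      case True
      then show ?thesis using False less.prems assms(1) by (simp add: q q')
    next
      case neq: False
      then have "1 \<le> k \<or> 1 \<le> i" by linarith
      then have "bump f q k = bump g q k"
        using less.IH[OF q(2,3)] less.prems q(2) by simp
      then show ?thesis using neq by (simp add: q q')
    qed
  qed
qed

lemma length_path_result [simp]: "length (path_result u p) = length u"
  by (simp add: path_result_def del: upt_Suc)

lemma ball_at_path_result:
  assumes "1 \<le> k" "k \<le> length u"
  shows "ball_at (path_result u p) k = (if k \<le> hd p then bump (ball_at u) p (k - 1) else ball_at u k)"
  using assms by (simp add: ball_at_def path_result_def del: upt_Suc)

lemma eq_if_ball_at_eq:
  assumes "length u = length v" "\<And>k. 1 \<le> k \<Longrightarrow> k \<le> length u \<Longrightarrow> ball_at u k = ball_at v k"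
  shows "u = v"
proof (rule nth_equalityI)
  fix k assume "k < length u"
  then show "u ! k = v ! k" using assms(2)[of "Suc k"] by (simp add: ball_at_def)
qed fact

text \<open>The ball from \<open>i + 1\<close> lands at \<open>i\<close>, and the final shift puts
  it back at \<open>i + 1\<close>, so the jump might as well start at \<open>i\<close>.\<close>

lemma path_result_adjacent:
  assumes "i < length u"
  shows "path_result u (Suc i # i # q) = path_result u (i # q)"
proof (rule eq_if_ball_at_eq)
  fix k assume "1 \<le> k" "k \<le> length (path_result u (Suc i # i # q))"
  then show "ball_at (path_result u (Suc i # i # q)) k = ball_at (path_result u (i # q)) k"
    by (auto simp: ball_at_path_result le_Suc_eq)
qed simp

text \<open>The final shift moves the missed ball from \<open>i\<close> to \<open>i + 1\<close>;
  exchanging it with the moving ball beforehand has the same effect.\<close>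

lemma path_result_skip:
  assumes "1 \<le> i" "i < length u" "i' < i" "q \<in> bump_paths i'"
  shows "path_result u (Suc i # q) = path_result (swap_adj i u) (i # q)"
proof (rule eq_if_ball_at_eq)
  obtain q' where q': "q = i' # q'" "sorted_wrt (>) q" using assms(4) by (rule bump_pathsE)
  fix k assume k: "1 \<le> k" "k \<le> length (path_result u (Suc i # q))"
  have moved: "bump (ball_at u) (Suc i # q) h = bump (ball_at (swap_adj i u)) (i # q) h" if "h < i" for h
  proof (cases "h = i'")
    case True
    then show ?thesis using assms by (simp add: q' ball_at_swap_adj)
  next
    case False
    \<comment> \<open>As \<open>h\<close> differs from \<open>i'\<close>, they are not both 0, so
      the junk value at 0 is not read.\<close>
    have "bump (ball_at u) q h = bump (ball_at (swap_adj i u)) q h"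
      using that assms False by (intro bump_cong[of i _ _ q i']) (auto simp: ball_at_swap_adj)
    then show ?thesis using False by (simp add: q')
  qed
  have kept: "bump (ball_at u) (Suc i # q) i = ball_at u i"
    using assms(3) q' by (intro bump_untouched) auto
  consider "k \<le> i" | "k = Suc i" | "Suc i < k" by linarith
  then show "ball_at (path_result u (Suc i # q)) k =
      ball_at (path_result (swap_adj i u) (i # q)) k"
    using k assms moved kept by cases (auto simp: ball_at_path_result ball_at_swap_adj simp del: bump.simps)
qed simp

text \<open>
  Induction step: after the exchange of positions \<open>k + 1\<close> and \<open>k + 2\<close>, a path from \<open>k + 2\<close> that misses
  \<open>k + 1\<close> becomes a path from \<open>k + 1\<close>; a path through \<open>k + 1\<close> loses its first entry.
\<close>

lemma sum_path_prob:
  assumes "k < length u"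
  shows "(\<Sum>p\<in>bump_paths (Suc k). path_prob \<alpha> u p * g (path_result u p)) = bump_op \<alpha> k g u"
  using assms
proof (induction k arbitrary: u)
  case 0
  \<comment> \<open>From position 1 the only path is \<open>[1, 0]\<close>, and the shift undoes
    it.\<close>
  have "smaller_left u (Suc 0) = {}" by (auto simp: smaller_left_def)
  then have "bump_prob \<alpha> u (Suc 0) 0 = 1" by (simp add: bump_prob_def)
  moreover have "path_result u [Suc 0, 0] = u"
    using 0 by (intro eq_if_ball_at_eq) (auto simp: ball_at_path_result le_Suc_eq)
  ultimately show ?case by (simp add: bump_paths_pos bump_paths_0 lessThan_Suc)
next
  case (Suc k)
  let ?F = "\<lambda>u p. path_prob \<alpha> u p * g (path_result u p)"
  let ?i = "Suc k"
  have i: "1 \<le> ?i" "?i < length u" using Suc.prems by auto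
  have stop: "?F u (Suc ?i # q) = stay_prob \<alpha> ?i u * ?F u q" if q: "q \<in> bump_paths ?i" for q
  proof -
    obtain q' where "q = ?i # q'" using q by (rule bump_pathsE)
    then show ?thesis using i by (simp add: bump_prob_adjacent path_result_adjacent)
  qed
  have skip: "?F u (Suc ?i # q) = (1 - stay_prob \<alpha> ?i u) * ?F (swap_adj ?i u) (?i # q)"
    if q: "i' < ?i" "q \<in> bump_paths i'" for i' q
  proof -
    obtain q' where q': "q = i' # q'" "sorted_wrt (>) q" using q(2) by (rule bump_pathsE)
    then have less: "\<forall>x\<in>set q. x < ?i" using q(1) by auto
    have "path_prob \<alpha> u (Suc ?i # q) = (1 - stay_prob \<alpha> ?i u) * path_prob \<alpha> (swap_adj ?i u) (?i # q)"
      using bump_prob_skip[OF i q(1)] path_prob_swap_adj[OF i q'(2) less] by (simp add: q'(1))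
    then show ?thesis using path_result_skip[OF i q] by simp
  qed
  have "(\<Sum>p\<in>bump_paths (Suc ?i). ?F u p) =
      (\<Sum>i'<?i. \<Sum>q\<in>bump_paths i'. ?F u (Suc ?i # q)) + (\<Sum>q\<in>bump_paths ?i. ?F u (Suc ?i # q))"
    by (simp only: sum_bump_paths[OF zero_less_Suc] sum.lessThan_Suc)
  also have "(\<Sum>i'<?i. \<Sum>q\<in>bump_paths i'. ?F u (Suc ?i # q)) =
      (1 - stay_prob \<alpha> ?i u) * (\<Sum>p\<in>bump_paths ?i. ?F (swap_adj ?i u) p)"
    unfolding sum_bump_paths[OF zero_less_Suc] sum_distrib_left
    by (intro sum.cong refl skip) auto
  also have "(\<Sum>q\<in>bump_paths ?i. ?F u (Suc ?i # q)) =
      stay_prob \<alpha> ?i u * (\<Sum>p\<in>bump_paths ?i. ?F u p)"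
    unfolding sum_distrib_left by (intro sum.cong refl stop)
  finally show ?case
    using Suc.IH[of u] Suc.IH[of "swap_adj ?i u"] i by (simp add: lazy_swap_def)
qed

section \<open>Transition probabilities through local steps\<close>

lemma mrjmc_eq_bump_op:
  "mrjmc s \<alpha> u v = (\<Sum>j=1..length u. s j * bump_op \<alpha> (j - 1) (\<lambda>x. if x = v then 1 else 0) u)"
  unfolding mrjmc_def
proof (intro sum.cong refl arg_cong2[where f = "(*)"])
  fix j assume j: "j \<in> {1..length u}"
  have "(\<Sum>p\<in>{p \<in> bump_paths j. path_result u p = v}. path_prob \<alpha> u p) =
      (\<Sum>p\<in>bump_paths j. path_prob \<alpha> u p * (if path_result u p = v then 1 else 0))"
    by (intro sum.mono_neutral_cong_left) auto
  also have "\<dots> = bump_op \<alpha> (j - 1) (\<lambda>x. if x = v then 1 else 0) u"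
    using sum_path_prob[of "j - 1" u \<alpha> "\<lambda>x. if x = v then 1 else 0"] j by fastforce
  finally show "(\<Sum>p\<in>{p \<in> bump_paths j. path_result u p = v}. path_prob \<alpha> u p) =
      bump_op \<alpha> (j - 1) (\<lambda>x. if x = v then 1 else 0) u" .
qed

text \<open>One step of the chain turns density \<open>h\<close> into the \<open>s\<close>-average
  of the functions \<open>bump_adj \<alpha> (j - 1) h\<close>, so stationarity becomes a fixed-point
  equation for densities.\<close>

lemma sum_mrjmc:
  assumes v: "v \<in> permutations_of_multiset M"
  shows "(\<Sum>u\<in>permutations_of_multiset M. code_weight \<alpha> u * h u * mrjmc s \<alpha> u v) =
    code_weight \<alpha> v * (\<Sum>j=1..size M. s j * bump_adj \<alpha> (j - 1) h v)"
proof -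
  let ?S = "permutations_of_multiset M" and ?w = "code_weight \<alpha>"
    and ?\<delta> = "\<lambda>x. if x = v then 1 else 0 :: real"
  have "(\<Sum>u\<in>?S. ?w u * h u * mrjmc s \<alpha> u v) =
      (\<Sum>u\<in>?S. \<Sum>j=1..size M. s j * (?w u * h u * bump_op \<alpha> (j - 1) ?\<delta> u))"
    by (intro sum.cong refl)
      (simp add: mrjmc_eq_bump_op length_finite_permutations_of_multiset sum_distrib_left mult_ac)
  also have "\<dots> = (\<Sum>j=1..size M. s j * (\<Sum>u\<in>?S. ?w u * h u * bump_op \<alpha> (j - 1) ?\<delta> u))"
    by (subst sum.swap) (simp add: sum_distrib_left)
  also have "\<dots> = (\<Sum>j=1..size M. s j * (\<Sum>u\<in>?S. ?w u * bump_adj \<alpha> (j - 1) h u * ?\<delta> u))"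
  proof -
    have "j - 1 < size M" if "j \<in> {1..size M}" for j using that by auto
    then show ?thesis by (simp only: bump_op_adjoint cong: sum.cong)
  qed
  also have "\<dots> = (\<Sum>j=1..size M. s j * (?w v * bump_adj \<alpha> (j - 1) h v))"
    using v by (simp add: if_distrib[of "(*) _"] sum.delta' cong: if_cong)
  also have "\<dots> = ?w v * (\<Sum>j=1..size M. s j * bump_adj \<alpha> (j - 1) h v)"
    by (simp add: sum_distrib_left mult_ac)
  finally show ?thesis .
qed

section \<open>Uniqueness\<close>

definition energy :: "nat multiset \<Rightarrow> (nat \<Rightarrow> real) \<Rightarrow> (nat list \<Rightarrow> real) \<Rightarrow> real" where
  "energy M \<alpha> h = (\<Sum>u\<in>permutations_of_multiset M. code_weight \<alpha> u * (h u)\<^sup>2)"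

text \<open>A local step averages two values, and each summand is the weighted variance
  \<open>p (1 - p) (x - y)^2\<close> of that two-point distribution.\<close>

lemma energy_lazy_swap:
  assumes "1 \<le> i" "i < size M"
  shows "energy M \<alpha> h - energy M \<alpha> (lazy_swap \<alpha> i h) =
    (\<Sum>u\<in>permutations_of_multiset M. code_weight \<alpha> u * (stay_prob \<alpha> i u * (1 - stay_prob \<alpha> i u))
       * (h u - h (swap_adj i u))\<^sup>2)"
proof -
  let ?S = "permutations_of_multiset M" and ?w = "code_weight \<alpha>" and ?p = "stay_prob \<alpha> i"
  \<comment> \<open>Pairing with the constant 1 shows that a local step preserves weighted sums,
    here that of the squares of \<open>h\<close>.\<close>
  have "energy M \<alpha> h = (\<Sum>u\<in>?S. ?w u * lazy_swap \<alpha> i (\<lambda>u. (h u)\<^sup>2) u)"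
    using lazy_swap_self_adjoint[OF assms, of \<alpha> "\<lambda>_. 1" "\<lambda>u. (h u)\<^sup>2"]
    by (simp add: energy_def lazy_swap_const)
  then have "energy M \<alpha> h - energy M \<alpha> (lazy_swap \<alpha> i h) =
      (\<Sum>u\<in>?S. ?w u * lazy_swap \<alpha> i (\<lambda>u. (h u)\<^sup>2) u - ?w u * (lazy_swap \<alpha> i h u)\<^sup>2)"
    by (simp add: energy_def sum_subtractf)
  also have "\<dots> = (\<Sum>u\<in>?S. ?w u * (?p u * (1 - ?p u)) * (h u - h (swap_adj i u))\<^sup>2)"
    by (intro sum.cong refl) (simp add: lazy_swap_def power2_eq_square algebra_simps)
  finally show ?thesis .
qed


section \<open>Adjacent exchanges connect all arrangements\<close>

lemma eq_if_invariant_adjacent: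
  assumes "\<And>A x y B. mset (A @ x # y # B) = M \<Longrightarrow> f (A @ x # y # B) = f (A @ y # x # B)"
    and "mset xs = mset ys" "mset (A @ xs) = M"
  shows "f (A @ xs) = f (A @ ys)"
  using assms(2,3)
proof (induction xs arbitrary: A ys)
  case Nil
  then show ?case by simp
next
  case (Cons x xs)
  \<comment> \<open>Carries \<open>x\<close> leftwards across \<open>P\<close> to the end of the
    prefix \<open>A\<close>, which then grows by \<open>x\<close> in the induction.\<close>
  have move: "f (A @ P @ x # Q) = f (A @ x # P @ Q)" if "mset (A @ P @ x # Q) = M" for P Q
    using that
  proof (induction P arbitrary: Q rule: rev_induct)
    case (snoc y P)
    have "f (A @ (P @ [y]) @ x # Q) = f (A @ P @ x # y # Q)"
      using assms(1)[of "A @ P" y x Q] snoc.prems by simp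
    also have "\<dots> = f (A @ x # P @ y # Q)"
      using snoc.IH[of "y # Q"] snoc.prems by (simp add: add_mset_commute)
    finally show ?case by simp
  qed simp
  obtain P Q where ys: "ys = P @ x # Q"
    using Cons.prems(1) by (metis list.set_intros(1) mset_eq_setD split_list)
  have "f (A @ x # xs) = f (A @ x # P @ Q)"
    using Cons.IH[of "P @ Q" "A @ [x]"] Cons.prems by (simp add: ys)
  also have "\<dots> = f (A @ ys)"
    using move[of P Q] Cons.prems by (simp add: ys)
  finally show ?case .
qed

lemma invariant_swap_adj_const:
  assumes "\<And>u i. u \<in> permutations_of_multiset M \<Longrightarrow> 1 \<le> i \<Longrightarrow> i < size M \<Longrightarrow> f (swap_adj i u) = f u"
    and "u \<in> permutations_of_multiset M" "v \<in> permutations_of_multiset M"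
  shows "f u = f v"
proof -
  have "f (A @ x # y # B) = f (A @ y # x # B)" if "mset (A @ x # y # B) = M" for A x y B
  proof -
    have "swap_adj (Suc (length A)) (A @ x # y # B) = A @ y # x # B"
      by (simp add: swap_adj_def nth_append list_update_append)
    moreover have "Suc (length A) < size M" using arg_cong[OF that, of size] by simp
    ultimately show ?thesis
      using assms(1)[of "A @ x # y # B" "Suc (length A)"] permutations_of_multisetI[OF that] by simp
  qed
  from eq_if_invariant_adjacent[of M f, OF this, of u v "[]"] show ?thesis
    using assms(2,3) by (simp add: permutations_of_multiset_def)
qed

section \<open>Rigidity when no energy is lost\<close>

context
  fixes M :: "nat multiset" and \<alpha> :: "nat \<Rightarrow> real"
  assumes weight_pos: "\<And>u. u \<in> permutations_of_multiset M \<Longrightarrow> 0 < code_weight \<alpha> u"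
    and skip_prob: "\<And>u i. u \<in> permutations_of_multiset M \<Longrightarrow> 1 \<le> i \<Longrightarrow> i < size M \<Longrightarrow>
      ball_at u i < ball_at u (Suc i) \<Longrightarrow> 0 < \<alpha> (Suc (code u (Suc i))) \<and> \<alpha> (Suc (code u (Suc i))) < 1"
begin

lemma energy_drop_nonneg:
  assumes "u \<in> permutations_of_multiset M" "1 \<le> i" "i < size M"
  shows "0 \<le> code_weight \<alpha> u * (stay_prob \<alpha> i u * (1 - stay_prob \<alpha> i u)) * (h u - h (swap_adj i u))\<^sup>2"
proof -
  have "0 \<le> stay_prob \<alpha> i u * (1 - stay_prob \<alpha> i u)"
    using skip_prob[OF assms] by (auto simp: stay_prob_def intro!: mult_nonneg_nonneg)
  then show ?thesis using weight_pos[OF assms(1)] by simp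
qed

lemma energy_lazy_swap_le:
  assumes "1 \<le> i" "i < size M"
  shows "energy M \<alpha> (lazy_swap \<alpha> i h) \<le> energy M \<alpha> h"
proof -
  have "0 \<le> energy M \<alpha> h - energy M \<alpha> (lazy_swap \<alpha> i h)"
    unfolding energy_lazy_swap[OF assms] by (intro sum_nonneg energy_drop_nonneg assms)
  then show ?thesis by simp
qed

lemma energy_bump_adj_le:
  assumes "i < size M"
  shows "energy M \<alpha> (bump_adj \<alpha> i h) \<le> energy M \<alpha> h"
  using assms
proof (induction i arbitrary: h)
  case (Suc i)
  then show ?case
    using order_trans[OF Suc.IH[of "lazy_swap \<alpha> (Suc i) h"] energy_lazy_swap_le[of "Suc i" h]] by simp
qed simp

text \<open>Every nonnegative summand of the energy drop vanishes. At an ascent its coefficient is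
  positive, so the two values of \<open>h\<close> agree; a descent becomes an ascent after the
  exchange.\<close>

lemma invariant_if_energy_lazy_swap_eq:
  assumes i: "1 \<le> i" "i < size M" and eq: "energy M \<alpha> (lazy_swap \<alpha> i h) = energy M \<alpha> h"
    and u: "u \<in> permutations_of_multiset M"
  shows "h (swap_adj i u) = h u"
proof -
  let ?S = "permutations_of_multiset M"
  have asc: "h (swap_adj i u) = h u" if u: "u \<in> ?S" and less: "ball_at u i < ball_at u (Suc i)" for u
  proof -
    have "(\<Sum>u\<in>?S. code_weight \<alpha> u * (stay_prob \<alpha> i u * (1 - stay_prob \<alpha> i u))
       * (h u - h (swap_adj i u))\<^sup>2) = 0"
      using energy_lazy_swap[OF i, of \<alpha> h] eq by simp
    then have "code_weight \<alpha> u * (stay_prob \<alpha> i u * (1 - stay_prob \<alpha> i u))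
       * (h u - h (swap_adj i u))\<^sup>2 = 0"
      using energy_drop_nonneg[OF _ i] u
      by (subst (asm) sum_nonneg_eq_0_iff) auto
    then show ?thesis
      using weight_pos[OF u] skip_prob[OF u i less] less by (simp add: stay_prob_def)
  qed
  have len: "i < length u" using u i by (simp add: length_finite_permutations_of_multiset)
  consider "ball_at u i < ball_at u (Suc i)" | "ball_at u (Suc i) < ball_at u i"
    | "ball_at u i = ball_at u (Suc i)" by linarith
  then show ?thesis
  proof cases
    case 1
    then show ?thesis using asc u by simp
  next
    case 2
    then have "h (swap_adj i (swap_adj i u)) = h (swap_adj i u)"
      using i len u by (intro asc) (auto simp: swap_adj_in_permutations ball_at_swap_adj)
    then show ?thesis using i len by (simp add: swap_adj_swap_adj)
  next
    case 3
    then show ?thesis by (simp add: swap_adj_eq)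
  qed
qed

text \<open>No local step can raise the energy, so equality overall forces equality at each of
  them.\<close>

lemma invariant_if_energy_bump_adj_eq:
  assumes "k < size M" "energy M \<alpha> (bump_adj \<alpha> k h) = energy M \<alpha> h"
    and "1 \<le> i" "i \<le> k" "u \<in> permutations_of_multiset M"
  shows "h (swap_adj i u) = h u"
  using assms
proof (induction k arbitrary: h)
  case (Suc k)
  let ?h' = "lazy_swap \<alpha> (Suc k) h"
  have k: "1 \<le> Suc k" "Suc k < size M" "k < size M" using Suc.prems by auto
  have eqs: "energy M \<alpha> ?h' = energy M \<alpha> h" "energy M \<alpha> (bump_adj \<alpha> k ?h') = energy M \<alpha> ?h'"
    using energy_lazy_swap_le[OF k(1,2), of h] energy_bump_adj_le[OF k(3), of ?h'] Suc.prems by auto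
  note inv = invariant_if_energy_lazy_swap_eq[OF k(1,2) eqs(1)]
  show ?case
  proof (cases "i = Suc k")
    case True
    then show ?thesis using inv Suc.prems by simp
  next
    case False
    \<comment> \<open>The lossless first step leaves \<open>h\<close> unchanged on the states, so
      invariance of \<open>?h'\<close> is invariance of \<open>h\<close>.\<close>
    have same: "?h' v = h v" if "v \<in> permutations_of_multiset M" for v
      using inv[OF that] by (simp add: lazy_swap_def algebra_simps)
    have "?h' (swap_adj i u) = ?h' u"
      using Suc.IH[of ?h'] k eqs(2) Suc.prems False by auto
    then show ?thesis using same Suc.prems by (simp add: swap_adj_in_permutations)
  qed
qed simp

lemma stationary_density_const:
  assumes s: "\<And>j. 1 \<le> j \<Longrightarrow> j \<le> size M \<Longrightarrow> s j \<ge> 0" "(\<Sum>j=1..size M. s j) = 1" "s (size M) > 0"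
    and "M \<noteq> {#}"
    and fixed: "\<And>u. u \<in> permutations_of_multiset M \<Longrightarrow>
      (\<Sum>j=1..size M. s j * bump_adj \<alpha> (j - 1) h u) = h u"
    and uv: "u \<in> permutations_of_multiset M" "v \<in> permutations_of_multiset M"
  shows "h u = h v"
proof -
  let ?S = "permutations_of_multiset M" and ?w = "code_weight \<alpha>" and ?n = "size M"
  let ?h = "\<lambda>j. bump_adj \<alpha> (j - 1) h"
  let ?drop = "\<lambda>j. s j * (energy M \<alpha> h - energy M \<alpha> (?h j))"
  have n: "1 \<le> ?n" using \<open>M \<noteq> {#}\<close> nonempty_has_size[of M] by linarith
  have drop: "0 \<le> ?drop j" if "j \<in> {1..?n}" for j
    using that s(1)[of j] energy_bump_adj_le[of "j - 1" h] by auto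
  \<comment> \<open>The inequality \<open>2 x y \<le> x^2 + y^2\<close>, summed with positive
    weights.\<close>
  have cross: "2 * (\<Sum>u\<in>?S. ?w u * h u * g u) \<le> energy M \<alpha> h + energy M \<alpha> g" for g
  proof -
    have "(\<Sum>u\<in>?S. ?w u * (2 * h u * g u)) \<le> (\<Sum>u\<in>?S. ?w u * ((h u)\<^sup>2 + (g u)\<^sup>2))"
      using weight_pos by (intro sum_mono mult_left_mono sum_squares_bound) (auto intro: less_imp_le)
    then show ?thesis
      by (simp add: energy_def sum.distrib sum_distrib_left algebra_simps)
  qed
  \<comment> \<open>One factor \<open>h\<close> is replaced by the average it equals. Since the
    \<open>s j\<close> sum to 1, the bound then forces the averaged energy drops to be at most
    0.\<close>
  have "2 * energy M \<alpha> h = 2 * (\<Sum>u\<in>?S. ?w u * h u * (\<Sum>j=1..?n. s j * ?h j u))"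
    by (simp only: energy_def fixed power2_eq_square mult.assoc cong: sum.cong)
  also have "\<dots> = (\<Sum>j=1..?n. s j * (2 * (\<Sum>u\<in>?S. ?w u * h u * ?h j u)))"
    unfolding sum_distrib_left by (subst sum.swap) (simp add: mult_ac)
  also have "\<dots> \<le> (\<Sum>j=1..?n. s j * (energy M \<alpha> h + energy M \<alpha> (?h j)))"
    using s(1) cross by (intro sum_mono mult_left_mono) auto
  also have "\<dots> = 2 * energy M \<alpha> h * (\<Sum>j=1..?n. s j) - (\<Sum>j=1..?n. ?drop j)"
    by (simp add: sum_distrib_left sum_distrib_right sum_subtractf sum.distrib algebra_simps)
  finally have "(\<Sum>j=1..?n. ?drop j) \<le> 0" using s(2) by simp
  moreover have "?drop ?n \<le> (\<Sum>j=1..?n. ?drop j)"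
    using drop n by (intro member_le_sum) auto
  ultimately have "?drop ?n \<le> 0" by linarith
  then have "energy M \<alpha> (?h ?n) = energy M \<alpha> h"
    using s(3) energy_bump_adj_le[of "?n - 1" h] n by (simp add: mult_le_0_iff)
  \<comment> \<open>A jump from the last position involves every exchange
    \<open>1, ..., size M - 1\<close>.\<close>
  then have "h (swap_adj i x) = h x" if "x \<in> ?S" "1 \<le> i" "i < ?n" for x i
    using that n by (intro invariant_if_energy_bump_adj_eq[of "?n - 1"]) auto
  then show ?thesis using uv by (rule invariant_swap_adj_const)
qed

text \<open>Stationarity makes the density of \<open>\<pi>\<close> constant, and total mass 1 fixes
  the constant as \<open>1 / partition_fun M \<alpha>\<close>. Conversely, constant densities are
  fixed points.\<close>

lemma stationary_distribution_mrjmc_iff: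
  assumes s: "\<And>j. 1 \<le> j \<Longrightarrow> j \<le> size M \<Longrightarrow> s j \<ge> 0" "(\<Sum>j=1..size M. s j) = 1" "s (size M) > 0"
    and "M \<noteq> {#}"
  shows "stationary_distribution (permutations_of_multiset M) (mrjmc s \<alpha>) \<pi> \<longleftrightarrow>
    (\<forall>\<tau>\<in>permutations_of_multiset M. \<pi> \<tau> = 1 / partition_fun M \<alpha> * code_weight \<alpha> \<tau>)"
proof -
  let ?S = "permutations_of_multiset M" and ?w = "code_weight \<alpha>" and ?Z = "partition_fun M \<alpha>"
  define h where "h = (\<lambda>u. \<pi> u / ?w u)"
  have \<pi>: "\<pi> u = ?w u * h u" if "u \<in> ?S" for u
    using weight_pos[OF that] by (simp add: h_def)
  have Z: "0 < ?Z" unfolding partition_fun_def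
    using weight_pos by (intro sum_pos) (auto simp: permutations_of_multiset_not_empty)
  have step: "(\<Sum>u\<in>?S. \<pi> u * mrjmc s \<alpha> u v) = ?w v * (\<Sum>j=1..size M. s j * bump_adj \<alpha> (j - 1) h v)"
    if "v \<in> ?S" for v
    using sum_mrjmc[OF that, of \<alpha> h s] by (simp add: \<pi>)
  show ?thesis
  proof
    assume st: "stationary_distribution ?S (mrjmc s \<alpha>) \<pi>"
    have fixed: "(\<Sum>j=1..size M. s j * bump_adj \<alpha> (j - 1) h v) = h v" if "v \<in> ?S" for v
      using st step[OF that] \<pi>[OF that] weight_pos[OF that] that
      by (auto simp: stationary_distribution_def)
    show "\<forall>\<tau>\<in>?S. \<pi> \<tau> = 1 / ?Z * ?w \<tau>"
    proof
      fix \<tau> assume \<tau>: "\<tau> \<in> ?S"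
      have "1 = (\<Sum>u\<in>?S. \<pi> u)" using st by (simp add: stationary_distribution_def)
      also have "\<dots> = (\<Sum>u\<in>?S. ?w u * h \<tau>)"
        using stationary_density_const[OF s \<open>M \<noteq> {#}\<close> fixed _ \<tau>] by (intro sum.cong) (auto simp: \<pi>)
      also have "\<dots> = ?Z * h \<tau>" by (simp add: partition_fun_def sum_distrib_right)
      finally show "\<pi> \<tau> = 1 / ?Z * ?w \<tau>" using Z \<pi>[OF \<tau>] by (simp add: field_simps)
    qed
  next
    assume eq: "\<forall>\<tau>\<in>?S. \<pi> \<tau> = 1 / ?Z * ?w \<tau>"
    have "(\<Sum>u\<in>?S. \<pi> u * mrjmc s \<alpha> u v) = \<pi> v" if v: "v \<in> ?S" for v
    proof -
      have "(\<Sum>u\<in>?S. \<pi> u * mrjmc s \<alpha> u v) = (\<Sum>u\<in>?S. ?w u * (1 / ?Z) * mrjmc s \<alpha> u v)"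
        using eq by (intro sum.cong) auto
      also have "\<dots> = ?w v * (\<Sum>j=1..size M. s j * (1 / ?Z))"
        using sum_mrjmc[OF v, of \<alpha> "\<lambda>_. 1 / ?Z" s] by (simp add: bump_adj_const)
      also have "\<dots> = \<pi> v" using s(2) eq v by (simp flip: sum_divide_distrib)
      finally show ?thesis .
    qed
    moreover have "(\<Sum>u\<in>?S. \<pi> u) = 1"
      using eq Z by (simp add: partition_fun_def flip: sum_divide_distrib)
    ultimately show "stationary_distribution ?S (mrjmc s \<alpha>) \<pi>"
      using eq Z weight_pos by (auto simp: stationary_distribution_def less_imp_le)
  qed
qed

end

section \<open>Index range of the non-bump probabilities\<close>

theorem theorem4p5:
  fixes T b :: nat and m :: "nat \<Rightarrow> nat" and M :: "nat multiset"
    and s \<alpha> :: "nat \<Rightarrow> real" and \<pi> :: "nat list \<Rightarrow> real"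
  assumes "\<And>i. 1 \<le> i \<Longrightarrow> i \<le> T \<Longrightarrow> m i \<ge> 1"
    and "M = (\<Sum>i=1..T. replicate_mset (m i) i)"
    and "b = (\<Sum>i=1..T. m i)"
    and "\<And>j. 1 \<le> j \<Longrightarrow> j \<le> b \<Longrightarrow> s j \<ge> 0"
    and "(\<Sum>j=1..b. s j) = 1"
    and "s b > 0"
    and "\<And>i. 1 \<le> i \<Longrightarrow> i \<le> b - m T \<Longrightarrow> 0 < \<alpha> i \<and> \<alpha> i < 1"
  shows "stationary_distribution (permutations_of_multiset M) (mrjmc s \<alpha>) \<pi> \<longleftrightarrow>
    (\<forall>\<tau>\<in>permutations_of_multiset M. \<pi> \<tau> = 1 / partition_fun M \<alpha> * code_weight \<alpha> \<tau>)"
proof -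
  let ?S = "permutations_of_multiset M"
  have "size (\<Sum>i\<in>I. replicate_mset (m i) i) = (\<Sum>i\<in>I. m i)" for I
    by (induction I rule: infinite_finite_induct) auto
  then have size: "size M = b" by (simp add: assms(2,3))
  have count: "count M x = (if 1 \<le> x \<and> x \<le> T then m x else 0)" for x
    by (simp add: assms(2) count_sum sum.delta cong: if_cong)
  \<comment> \<open>A label below \<open>x\<close> is below \<open>T\<close>, so none of the
    \<open>m T\<close> balls labelled \<open>T\<close> is counted.\<close>
  have bound: "card {k. 1 \<le> k \<and> k \<le> b \<and> ball_at u k < x} \<le> b - m T"
    if u: "u \<in> ?S" and x: "x \<in># M" for u x
  proof -
    have mset: "mset u = M" and len: "length u = b"
      using u size by (auto simp: permutations_of_multiset_def)
    have xT: "1 \<le> x" "x \<le> T" using x by (auto simp: count split: if_splits simp flip: count_greater_zero_iff)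
    have "card {k\<in>{1..b}. ball_at u k = T} = card {k. k < length u \<and> u ! k = T}"
      by (rule bij_betw_same_card[of "\<lambda>k. k - 1"], rule bij_betw_byWitness[where f' = Suc])
        (auto simp: ball_at_def len)
    also have "\<dots> = m T"
      using count[of T] xT mset
      by (auto simp: count_mset count_list_eq_length_filter length_filter_conv_card eq_commute[of T])
    finally have T: "card {k\<in>{1..b}. ball_at u k = T} = m T" .
    have "card {k. 1 \<le> k \<and> k \<le> b \<and> ball_at u k < x} \<le> card ({1..b} - {k\<in>{1..b}. ball_at u k = T})"
      using xT by (intro card_mono) auto
    also have "\<dots> = b - m T"
      using T by (subst card_Diff_subset) auto
    finally show ?thesis .
  qed
  have ball_mem: "ball_at u k \<in># M" if "u \<in> ?S" "1 \<le> k" "k \<le> b" for u k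
  proof -
    have "mset u = M" "k - 1 < length u"
      using that size by (auto simp: permutations_of_multiset_def)
    then show ?thesis by (auto simp: ball_at_def)
  qed
  show ?thesis
    unfolding size[symmetric]
  proof (rule stationary_distribution_mrjmc_iff)
    fix u assume u: "u \<in> ?S"
    have "0 < (\<Prod>v=1..code u k. \<alpha> v)" if k: "k \<in> {1..length u}" for k
    proof (intro prod_pos)
      have len: "length u = b" using u size by (simp add: length_finite_permutations_of_multiset)
      have "code u k \<le> card {l. 1 \<le> l \<and> l \<le> b \<and> ball_at u l < ball_at u k}"
        unfolding code_def len by (intro card_mono) auto
      also have "\<dots> \<le> b - m T" using u k len by (intro bound ball_mem) auto
      finally show "0 < \<alpha> v" if "v \<in> {1..code u k}" for v
        using that assms(7)[of v] by auto
    qed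
    then show "0 < code_weight \<alpha> u" unfolding code_weight_def by (rule prod_pos)
  next
    fix u i assume u: "u \<in> ?S" and i: "1 \<le> i" "i < size M" and less: "ball_at u i < ball_at u (Suc i)"
    have len: "length u = b" using u size by (simp add: length_finite_permutations_of_multiset)
    have fin: "finite (smaller_right u (Suc i))" by (simp add: smaller_right_def)
    \<comment> \<open>At an ascent the ball at \<open>i\<close> is one more smaller ball, not yet
      counted by the code entry at \<open>i + 1\<close>; hence the bound also covers the
      successor.\<close>
    have "Suc (code u (Suc i)) = card (insert i (smaller_right u (Suc i)))"
      unfolding code_eq_card_smaller_right
      using fin by (subst card_insert_disjoint) (auto simp: smaller_right_def)
    also have "\<dots> \<le> card {l. 1 \<le> l \<and> l \<le> b \<and> ball_at u l < ball_at u (Suc i)}"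
      using i less len size by (intro card_mono) (auto simp: smaller_right_def)
    also have "\<dots> \<le> b - m T" using u i size by (intro bound ball_mem) auto
    finally show "0 < \<alpha> (Suc (code u (Suc i))) \<and> \<alpha> (Suc (code u (Suc i))) < 1"
      using assms(7)[of "Suc (code u (Suc i))"] by simp
  next
    \<comment> \<open>With \<open>b = 0\<close> the sum of the jump probabilities would be empty and
      not 1.\<close>
    show "M \<noteq> {#}" using assms(5) size by auto
  qed (use assms(4-6) size in auto)
qed

end
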